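(* Let $\pi$ be a noncrossing partition. Then, in $\mathbb{K}[X]$, $$\phi_{\mathcal{NCP}}(\pi)(X+1)=\phi_{\mathcal{NCP}}(\pi)(X)+\sum_{b\in\mathrm{Base}(\pi)}\phi_{\mathcal{NCP}}\big(\pi_{\mid[1,\min(b)[}\big)\,\phi_{\mathcal{NCP}}\big(\pi_{\mid_\cdot[\min(b),\max(b)]\setminus b}\big)\,\phi_{\mathcal{NCP}}\big(\pi_{\mid]\max(b),\infty[}\big).$$ Together with $\phi_{\mathcal{NCP}}(\pi)(0)=0$, this characterizes $\phi_{\mathcal{NCP}}(\pi)$ (inductively on the number of blocks: the noncrossing partitions occurring in the sum have fewer blocks than $\pi$, and $\phi_{\mathcal{NCP}}(\pi)$ is the only polynomial vanishing at $0$ that satisfies this equation).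
   Context: $\mathbb{K}$ is a field of characteristic zero. A noncrossing partition is a partition $\pi$ of a set $[n]=\{1,\ldots,n\}$, $n\ge1$, into nonempty blocks such that there are no distinct blocks $b\ne b'$ and $x,z\in b$, $y,t\in b'$ with $x<y<z<t$. $|\pi|$ is its number of blocks; $\mathcal{NCP}$ is the set of all noncrossing partitions. For a set $Y$ of blocks of $\pi$ (or a subset of $[n]$ that is a union of blocks, identified with the set of blocks it contains), $\pi_{\mid Y}$ is the noncrossing partition obtained by deleting the blocks not in $Y$ and renumbering the remaining elements increasingly; $\pi_{\mid\emptyset}=1$. The nesting order on blocks is $b\le_\pi b'\iff b'\subseteq[\min b,\max b]$; $\mathrm{Base}(\pi)$ is the set of blocks of $\pi$ that are minimal for $\le_\pi$. An ideal of $\pi$ is a set $J$ of blocks that is upward closed for $\le_\pi$; then the union of its blocks decomposes into maximal subsets of consecutive integers $I_1,\ldots,I_k$, each a union of blocks, and $\pi_{\mid_\cdot J}=\prod_i\pi_{\mid I_i}$ (product $\cdot$ below; $\pi_{\mid_\cdot\emptyset}=1$). $\mathbb{K}[\mathcal{NCP}]$ is the free commutative algebra generated by $\mathcal{NCP}$, with product $\cdot$ and unit $1$. It carries two coproducts which are algebra morphisms, given on $\pi\in\mathcal{NCP}$ by $\Delta(\pi)=\sum_{J\text{ ideal of }\pi}\pi_{\mid\pi\setminus J}\otimes\pi_{\mid_\cdot J}$ and $\delta(\pi)=\sum_{\sim\in\mathcal{E}_c[\pi]}\pi/\!\sim\,\otimes\,\pi\mid_\cdot\sim$, where, for an equivalence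 $\sim$ on the set of blocks of $\pi$, $\pi/\!\sim$ is the partition whose blocks are the unions of the blocks in each class, $\mathcal{E}_c[\pi]$ is the set of $\sim$ for which $\pi/\!\sim$ is noncrossing, and $\pi\mid_\cdot\sim=\prod_{C\text{ class of }\sim}\pi_{\mid C}$. The counits are the algebra morphisms with $\varepsilon_\Delta(\pi)=0$, and $\epsilon_\delta(\pi)=1$ if $|\pi|=1$, $\epsilon_\delta(\pi)=0$ otherwise. $\mathbb{K}[X]$ has the multiplicative coproducts $\Delta(X)=X\otimes1+1\otimes X$, $\delta(X)=X\otimes X$ with counits $P\mapsto P(0)$, $P\mapsto P(1)$. $\phi_{\mathcal{NCP}}:\mathbb{K}[\mathcal{NCP}]\to\mathbb{K}[X]$ is the unique algebra morphism compatible with both coproducts $\Delta,\delta$ and both counits. By known results it exists, is unique, and for $x\in\ker\varepsilon_\Delta$, $\phi_{\mathcal{NCP}}(x)=\sum_{k\ge1}\epsilon_\delta^{\otimes k}\circ\tilde\Delta^{(k-1)}(x)\,H_k(X)$, with $\tilde\Delta(x)=\Delta(x)-x\otimes1-1\otimes x$, $\tilde\Delta^{(k-1)}$ its iterates ($\tilde\Delta^{(0)}=\mathrm{Id}$), and $H_k(X)=X(X-1)\cdots(X-k+1)/k!$. *)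

theory Defs
  imports
    "HOL-Library.Poly_Mapping"
    "HOL-Library.Product_Plus"
    "HOL-Library.Multiset"
    "HOL-Library.Disjoint_Sets"
    "HOL-Computational_Algebra.Polynomial"
begin

definition noncrossing :: "nat set set \<Rightarrow> bool" where
  "noncrossing P \<longleftrightarrow>
     \<not> (\<exists>b\<in>P. \<exists>b'\<in>P. b \<noteq> b' \<and>
          (\<exists>x\<in>b. \<exists>z\<in>b. \<exists>y\<in>b'. \<exists>t\<in>b'. x < y \<and> y < z \<and> z < t))"

definition is_ncp :: "nat set set \<Rightarrow> bool" where
  "is_ncp P \<longleftrightarrow> (\<exists>n\<ge>1. partition_on {1..n} P \<and> noncrossing P)"

typedef ncp = "{P :: nat set set. is_ncp P}"
  morphisms blocks Abs_ncp
proof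
  have "is_ncp {{1..1}}"
    unfolding is_ncp_def by (intro exI[of _ 1]) (simp add: partition_on_def noncrossing_def)
  then show "{{1..1}} \<in> {P. is_ncp P}" by simp
qed

definition num_blocks :: "ncp \<Rightarrow> nat" where
  "num_blocks \<pi> = card (blocks \<pi>)"

definition nest_le :: "nat set \<Rightarrow> nat set \<Rightarrow> bool" where
  "nest_le b b' \<longleftrightarrow> b' \<subseteq> {Min b..Max b}"

definition Base :: "ncp \<Rightarrow> nat set set" where
  "Base \<pi> = {b \<in> blocks \<pi>. \<forall>b'\<in>blocks \<pi>. nest_le b' b \<longrightarrow> b' = b}"

definition ideals :: "ncp \<Rightarrow> nat set set set" where
  "ideals \<pi> = {J. J \<subseteq> blocks \<pi> \<and> (\<forall>b\<in>J. \<forall>b'\<in>blocks \<pi>. nest_le b b' \<longrightarrow> b' \<in> J)}"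

definition rank_in :: "nat set \<Rightarrow> nat \<Rightarrow> nat" where
  "rank_in A x = card {y \<in> A. y \<le> x}"

definition renumber :: "nat set set \<Rightarrow> nat set set" where
  "renumber Y = (\<lambda>b. rank_in (\<Union>Y) ` b) ` Y"

definition is_run :: "nat set \<Rightarrow> nat set \<Rightarrow> bool" where
  "is_run A I \<longleftrightarrow> I \<noteq> {} \<and> I \<subseteq> A \<and> (\<exists>a c. I = {a..c})"

definition runs :: "nat set \<Rightarrow> nat set set" where
  "runs A = {I. is_run A I \<and> (\<forall>I'. is_run A I' \<and> I \<subseteq> I' \<longrightarrow> I' = I)}"

definition quotient_blocks :: "ncp \<Rightarrow> (nat set \<times> nat set) set \<Rightarrow> nat set set" where
  "quotient_blocks \<pi> r = \<Union> ` (blocks \<pi> // r)"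

definition nc_equivs :: "ncp \<Rightarrow> (nat set \<times> nat set) set set" where
  "nc_equivs \<pi> = {r. equiv (blocks \<pi>) r \<and> noncrossing (quotient_blocks \<pi> r)}"

text \<open>The next two lemmas ensure that \<open>Abs_ncp\<close> is only ever applied below to
  noncrossing partitions.\<close>

lemma is_ncp_renumber:
  assumes P: "is_ncp P" and Y: "Y \<subseteq> P" "Y \<noteq> {}"
  shows "is_ncp (renumber Y)"
proof -
  obtain n where part: "partition_on {1..n} P" and nc: "noncrossing P"
    using P by (auto simp: is_ncp_def)
  define A where "A = \<Union>Y"
  have A: "A \<subseteq> {1..n}" using part Y unfolding partition_on_def A_def by blast
  have finA: "finite A" using A finite_subset by blast
  have partY: "partition_on A Y"
    using part Y unfolding A_def partition_on_def disjoint_def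
    by (metis subsetD)
  obtain b0 where "b0 \<in> Y" using Y by blast
  then have "b0 \<noteq> {}" "b0 \<subseteq> A" using partY by (auto simp: partition_on_def A_def)
  then have "A \<noteq> {}" by auto
  then have c1: "card A \<ge> 1" using finA by (simp add: Suc_leI card_gt_0_iff)
  have mono: "rank_in A x < rank_in A y" if "x \<in> A" "y \<in> A" "x < y" for x y
  proof -
    have "y \<notin> {z \<in> A. z \<le> x}" "y \<in> {z \<in> A. z \<le> y}" "{z \<in> A. z \<le> x} \<subseteq> {z \<in> A. z \<le> y}"
      using that by auto
    then have "{z \<in> A. z \<le> x} \<subset> {z \<in> A. z \<le> y}" by blast
    then show ?thesis unfolding rank_in_def by (rule psubset_card_mono[rotated]) (use finA in simp)
  qed
  have inj: "inj_on (rank_in A) A"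
    by (rule inj_onI) (metis linorder_neqE_nat mono less_irrefl)
  have "rank_in A ` A \<subseteq> {1..card A}"
  proof
    fix k assume "k \<in> rank_in A ` A"
    then obtain x where x: "x \<in> A" "k = card {y \<in> A. y \<le> x}" by (auto simp: rank_in_def)
    have "card {y \<in> A. y \<le> x} > 0" using x finA by (auto simp: card_gt_0_iff)
    moreover have "card {y \<in> A. y \<le> x} \<le> card A" by (rule card_mono) (use finA in auto)
    ultimately show "k \<in> {1..card A}" using x by auto
  qed
  then have img: "rank_in A ` A = {1..card A}"
    by (rule card_subset_eq[rotated]) (simp_all add: card_image[OF inj])
  have "partition_on (rank_in A ` A) ((`) (rank_in A) ` Y)"
    unfolding partition_on_def
  proof (intro conjI)
    show "\<Union> ((`) (rank_in A) ` Y) = rank_in A ` A" by (auto simp: A_def)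
    show "disjoint ((`) (rank_in A) ` Y)"
      unfolding disjoint_def
    proof (intro ballI impI)
      fix B C assume "B \<in> (`) (rank_in A) ` Y" "C \<in> (`) (rank_in A) ` Y" "B \<noteq> C"
      then obtain b c where bc: "b \<in> Y" "c \<in> Y" "B = rank_in A ` b" "C = rank_in A ` c" "b \<noteq> c"
        by blast
      then have "b \<inter> c = {}" using partY by (auto simp: partition_on_def disjoint_def)
      moreover have "b \<subseteq> A" "c \<subseteq> A" using bc by (auto simp: A_def)
      ultimately show "B \<inter> C = {}" using inj_on_image_Int[OF inj, of b c] bc by simp
    qed
    show "{} \<notin> (`) (rank_in A) ` Y" using partY by (auto simp: partition_on_def)
  qed
  then have "partition_on {1..card A} (renumber Y)"
    unfolding img by (simp add: renumber_def A_def)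
  moreover have "noncrossing (renumber Y)"
    unfolding noncrossing_def
  proof (intro notI)
    assume "\<exists>b\<in>renumber Y. \<exists>b'\<in>renumber Y. b \<noteq> b' \<and>
      (\<exists>x\<in>b. \<exists>z\<in>b. \<exists>y\<in>b'. \<exists>t\<in>b'. x < y \<and> y < z \<and> z < t)"
    then obtain b b' x y z t where *: "b \<in> Y" "b' \<in> Y" "b \<noteq> b'" "x \<in> b" "z \<in> b" "y \<in> b'" "t \<in> b'"
      "rank_in A x < rank_in A y" "rank_in A y < rank_in A z" "rank_in A z < rank_in A t"
      unfolding renumber_def A_def by blast
    then have "x \<in> A" "y \<in> A" "z \<in> A" "t \<in> A" by (auto simp: A_def)
    then have "x < y" "y < z" "z < t" using * mono by (metis less_asym linorder_neqE_nat less_irrefl)+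
    then show False using * Y nc unfolding noncrossing_def by (meson subsetD)
  qed
  ultimately show ?thesis using c1 by (auto simp: is_ncp_def)
qed

lemma is_ncp_quotient_blocks:
  assumes "r \<in> nc_equivs \<pi>"
  shows "is_ncp (quotient_blocks \<pi> r)"
proof -
  obtain n where n: "n \<ge> 1" and part: "partition_on {1..n} (blocks \<pi>)"
    using blocks[of \<pi>] by (auto simp: is_ncp_def)
  have eq: "equiv (blocks \<pi>) r" and nc: "noncrossing (quotient_blocks \<pi> r)"
    using assms by (auto simp: nc_equivs_def)
  have "partition_on {1..n} (quotient_blocks \<pi> r)"
    unfolding partition_on_def
  proof (intro conjI)
    have "\<Union> (quotient_blocks \<pi> r) = \<Union> (\<Union> (blocks \<pi> // r))"
      by (auto simp: quotient_blocks_def)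
    then show "\<Union> (quotient_blocks \<pi> r) = {1..n}"
      using Union_quotient[OF eq] part by (simp add: partition_on_def)
    show "disjoint (quotient_blocks \<pi> r)"
      unfolding disjoint_def
    proof (intro ballI impI)
      fix B C assume "B \<in> quotient_blocks \<pi> r" "C \<in> quotient_blocks \<pi> r" "B \<noteq> C"
      then obtain U V where UV: "U \<in> blocks \<pi> // r" "V \<in> blocks \<pi> // r" "B = \<Union>U" "C = \<Union>V" "U \<noteq> V"
        by (auto simp: quotient_blocks_def)
      have dUV: "U \<inter> V = {}" using quotient_disj[OF eq UV(1,2)] UV by blast
      have sub: "U \<subseteq> blocks \<pi>" "V \<subseteq> blocks \<pi>" using Union_quotient[OF eq] UV by auto
      have "u \<inter> v = {}" if "u \<in> U" "v \<in> V" for u v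
      proof -
        have "u \<noteq> v" "u \<in> blocks \<pi>" "v \<in> blocks \<pi>" using that dUV sub by auto
        then show ?thesis using part by (auto simp: partition_on_def disjoint_def)
      qed
      then show "B \<inter> C = {}" using UV by blast
    qed
    show "{} \<notin> quotient_blocks \<pi> r"
    proof
      assume "{} \<in> quotient_blocks \<pi> r"
      then obtain U where U: "U \<in> blocks \<pi> // r" "\<Union>U = {}" by (auto simp: quotient_blocks_def)
      have "U \<noteq> {}" using in_quotient_imp_non_empty[OF eq U(1)] .
      moreover have "U \<subseteq> blocks \<pi>" using Union_quotient[OF eq] U by auto
      ultimately show False using U part by (auto simp: partition_on_def)
    qed
  qed
  then show ?thesis using n nc by (auto simp: is_ncp_def)
qed

text \<open>The free commutative algebra on \<open>ncp\<close> is the monoid algebra of the free commutative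
  monoid \<open>ncp multiset\<close>; the multiplication of \<open>poly_mapping\<close> is convolution. The tensor
  square of a monoid algebra \<open>K[M]\<close> is identified with \<open>K[M \<times> M]\<close>.\<close>

type_synonym 'k ncp_alg = "ncp multiset \<Rightarrow>\<^sub>0 'k"
type_synonym 'k ncp_alg2 = "(ncp multiset \<times> ncp multiset) \<Rightarrow>\<^sub>0 'k"

definition gen :: "ncp \<Rightarrow> 'k::field_char_0 ncp_alg" where
  "gen \<pi> = Poly_Mapping.single {#\<pi>#} 1"

definition tensor :: "'k::field_char_0 ncp_alg \<Rightarrow> 'k ncp_alg \<Rightarrow> 'k ncp_alg2" where
  "tensor x y = (\<Sum>m\<in>Poly_Mapping.keys x. \<Sum>n\<in>Poly_Mapping.keys y.
     Poly_Mapping.single (m, n) (Poly_Mapping.lookup x m * Poly_Mapping.lookup y n))"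

text \<open>Algebra morphism extending \<open>f\<close>, into an algebra with structure map \<open>s\<close>.\<close>

definition alg_extend ::
    "('k::field_char_0 \<Rightarrow> 'a::comm_ring_1) \<Rightarrow> (ncp \<Rightarrow> 'a) \<Rightarrow> 'k ncp_alg \<Rightarrow> 'a" where
  "alg_extend s f x = (\<Sum>m\<in>Poly_Mapping.keys x.
     s (Poly_Mapping.lookup x m) * prod_mset (image_mset f m))"

text \<open>A set \<open>Y\<close> of blocks determines \<open>\<pi>\<close> restricted to \<open>Y\<close>, without reference to \<open>\<pi>\<close>. The
  runs of \<open>\<Union>J\<close> are unions of blocks when \<open>J\<close> is an ideal, which is the only case in
  which \<open>restrict_blocks_dot\<close> is used.\<close>

definition restrict_blocks :: "nat set set \<Rightarrow> 'k::field_char_0 ncp_alg" where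
  "restrict_blocks Y = (if Y = {} then 1 else gen (Abs_ncp (renumber Y)))"

definition restrict_blocks_dot :: "nat set set \<Rightarrow> 'k::field_char_0 ncp_alg" where
  "restrict_blocks_dot J = (\<Prod>I\<in>runs (\<Union>J). restrict_blocks {b \<in> J. b \<subseteq> I})"

definition restrict_to :: "ncp \<Rightarrow> nat set \<Rightarrow> 'k::field_char_0 ncp_alg" where
  "restrict_to \<pi> S = restrict_blocks {b \<in> blocks \<pi>. b \<subseteq> S}"

definition restrict_dot_to :: "ncp \<Rightarrow> nat set \<Rightarrow> 'k::field_char_0 ncp_alg" where
  "restrict_dot_to \<pi> S = restrict_blocks_dot {b \<in> blocks \<pi>. b \<subseteq> S}"

definition Delta :: "'k::field_char_0 ncp_alg \<Rightarrow> 'k ncp_alg2" where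
  "Delta = alg_extend (Poly_Mapping.single 0)
     (\<lambda>\<pi>. \<Sum>J\<in>ideals \<pi>. tensor (restrict_blocks (blocks \<pi> - J)) (restrict_blocks_dot J))"

definition delta :: "'k::field_char_0 ncp_alg \<Rightarrow> 'k ncp_alg2" where
  "delta = alg_extend (Poly_Mapping.single 0)
     (\<lambda>\<pi>. \<Sum>r\<in>nc_equivs \<pi>.
        tensor (gen (Abs_ncp (quotient_blocks \<pi> r))) (\<Prod>C\<in>blocks \<pi> // r. restrict_blocks C))"

definition eps_Delta :: "'k::field_char_0 ncp_alg \<Rightarrow> 'k" where
  "eps_Delta = alg_extend id (\<lambda>_. 0)"

definition eps_delta :: "'k::field_char_0 ncp_alg \<Rightarrow> 'k" where
  "eps_delta = alg_extend id (\<lambda>\<pi>. if num_blocks \<pi> = 1 then 1 else 0)"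

definition ncps_in :: "'k::field_char_0 ncp_alg \<Rightarrow> ncp set" where
  "ncps_in x = (\<Union>m\<in>Poly_Mapping.keys x. set_mset m)"

text \<open>The tensor square of \<open>K[X]\<close> is identified with \<open>K[X][Y]\<close>: the outer variable is
  \<open>X \<otimes> 1\<close> and the inner one is \<open>1 \<otimes> X\<close>.\<close>

definition ptensor :: "'k::field_char_0 poly \<Rightarrow> 'k poly \<Rightarrow> 'k poly poly" where
  "ptensor P Q = map_poly (\<lambda>c. [:c:]) P * [:Q:]"

abbreviation X_poly :: "'k::field_char_0 poly" where
  "X_poly \<equiv> [:0, 1:]"

definition poly_eval2 :: "'k::field_char_0 poly \<Rightarrow> 'k poly poly \<Rightarrow> 'k poly poly" where
  "poly_eval2 P u = poly (map_poly (\<lambda>c. [:[:c:]:]) P) u"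

definition poly_Delta :: "'k::field_char_0 poly \<Rightarrow> 'k poly poly" where
  "poly_Delta P = poly_eval2 P (ptensor X_poly 1 + ptensor 1 X_poly)"

definition poly_delta :: "'k::field_char_0 poly \<Rightarrow> 'k poly poly" where
  "poly_delta P = poly_eval2 P (ptensor X_poly X_poly)"

definition alg_morphism :: "('k::field_char_0 ncp_alg \<Rightarrow> 'k poly) \<Rightarrow> bool" where
  "alg_morphism \<phi> \<longleftrightarrow>
     \<phi> 1 = 1 \<and>
     (\<forall>x y. \<phi> (x + y) = \<phi> x + \<phi> y) \<and>
     (\<forall>x y. \<phi> (x * y) = \<phi> x * \<phi> y) \<and>
     (\<forall>c x. \<phi> (Poly_Mapping.single 0 c * x) = smult c (\<phi> x))"

text \<open>This is \<open>\<phi> \<otimes> \<phi>\<close> for linear \<open>\<phi>\<close>, written in the monomial basis.\<close>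

definition tensor_map ::
    "('k::field_char_0 ncp_alg \<Rightarrow> 'k poly) \<Rightarrow> 'k ncp_alg2 \<Rightarrow> 'k poly poly" where
  "tensor_map \<phi> u = (\<Sum>(m, n)\<in>Poly_Mapping.keys u.
     smult [:Poly_Mapping.lookup u (m, n):]
       (ptensor (\<phi> (Poly_Mapping.single m 1)) (\<phi> (Poly_Mapping.single n 1))))"

definition double_bialgebra_morphism :: "('k::field_char_0 ncp_alg \<Rightarrow> 'k poly) \<Rightarrow> bool" where
  "double_bialgebra_morphism \<phi> \<longleftrightarrow>
     alg_morphism \<phi> \<and>
     (\<forall>x. tensor_map \<phi> (Delta x) = poly_Delta (\<phi> x)) \<and>
     (\<forall>x. tensor_map \<phi> (delta x) = poly_delta (\<phi> x)) \<and>
     (\<forall>x. poly (\<phi> x) 0 = eps_Delta x) \<and>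
     (\<forall>x. poly (\<phi> x) 1 = eps_delta x)"

definition base_sum :: "('k::field_char_0 ncp_alg \<Rightarrow> 'k poly) \<Rightarrow> ncp \<Rightarrow> 'k poly" where
  "base_sum \<phi> \<pi> = (\<Sum>b\<in>Base \<pi>.
     \<phi> (restrict_to \<pi> {1..<Min b}) *
     \<phi> (restrict_dot_to \<pi> ({Min b..Max b} - b)) *
     \<phi> (restrict_to \<pi> {Max b<..}))"

end

theory Submission
  imports Defs
begin

text \<open>
  The shift \<open>X \<mapsto> X + 1\<close> is the coproduct of \<open>K[X]\<close> followed by evaluation of the left tensor
  factor at \<open>1\<close>. Evaluation of \<open>\<phi> x\<close> at \<open>1\<close> is \<open>eps_delta x\<close>, so compatibility of \<open>\<phi>\<close> with
  \<open>Delta\<close> and with the counit of \<open>delta\<close> turns \<open>\<phi>(\<pi>)(X + 1)\<close> into a sum over the ideals \<open>J\<close>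
  of \<open>\<pi>\<close> of \<open>\<phi>\<close> of the restriction to \<open>J\<close>, weighted by \<open>eps_delta\<close> of the restriction to the
  complement of \<open>J\<close> (\<open>shifted_morphism_gen\<close>). The weight is \<open>1\<close> if the complement has at most
  one block and \<open>0\<close> otherwise. The empty complement contributes \<open>\<phi>(\<pi>)\<close>. The complement \<open>{b}\<close>
  belongs to an ideal exactly when \<open>b\<close> is minimal for the nesting order, that is, a base block.

  It remains to compute the restriction to the ideal obtained by removing a base block \<open>b\<close>. Any
  other block lies entirely before \<open>Min b\<close>, between \<open>Min b\<close> and \<open>Max b\<close>, or after \<open>Max b\<close>:
  straddling just one of the two points is a crossing, and straddling both contradicts minimality
  (\<open>base_block_sides\<close>). As \<open>Min b\<close> and \<open>Max b\<close> are not covered, no run joins two of the three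
  zones, and the restriction is the product of three factors; the two outer zones are
  intervals, so there the product over runs has at most one factor
  (\<open>restrict_blocks_dot_remove_base\<close>).

  For uniqueness, the difference of two solutions of the shift equation with equal value at \<open>0\<close>
  vanishes at all natural numbers, which are infinitely many points of a field of characteristic
  zero (\<open>shift_zero_unique\<close>). Since all partitions in the sum have fewer blocks than \<open>\<pi>\<close>,
  induction on the number of blocks shows that two algebra morphisms satisfying the recurrence
  agree on generators, hence everywhere.
\<close>

section \<open>Monomials of the free commutative algebra\<close>

text \<open>Every tensor factor in the formula for \<open>Delta\<close> on a generator is a monomial with coefficient
  \<open>1\<close>. Hence a sum of pure tensors needs only additivity of \<open>tensor_map\<close>, never its bilinear
  expansion.\<close>

lemma monomial_restrict_blocks:
  "\<exists>m. restrict_blocks Y = (Poly_Mapping.single m 1 :: 'k::field_char_0 ncp_alg)"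
proof (cases "Y = {}")
  case True
  then show ?thesis
    by (intro exI[of _ "{#}"]) (simp add: restrict_blocks_def)
next
  case False
  then show ?thesis
    by (intro exI[of _ "{#Abs_ncp (renumber Y)#}"]) (simp add: restrict_blocks_def gen_def)
qed

lemma monomial_prod:
  assumes "\<And>i. i \<in> A \<Longrightarrow> \<exists>m. f i = (Poly_Mapping.single m 1 :: 'k::field_char_0 ncp_alg)"
  shows "\<exists>m. prod f A = Poly_Mapping.single m 1"
  using assms
proof (induction A rule: infinite_finite_induct)
  case (insert i A)
  then obtain m n where "f i = Poly_Mapping.single m 1" "prod f A = Poly_Mapping.single n 1"
    by (meson insertCI)
  then show ?case using insert.hyps by (auto simp: mult_single)
qed (auto intro!: exI[of _ "{#}"])

lemma monomial_restrict_blocks_dot: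
  "\<exists>m. restrict_blocks_dot J = (Poly_Mapping.single m 1 :: 'k::field_char_0 ncp_alg)"
  unfolding restrict_blocks_dot_def
  by (rule monomial_prod) (use monomial_restrict_blocks in blast)

lemma tensor_monomial:
  "tensor (Poly_Mapping.single m 1) (Poly_Mapping.single n 1 :: 'k::field_char_0 ncp_alg) =
     Poly_Mapping.single (m, n) 1"
  by (simp add: tensor_def)

lemma alg_extend_gen:
  assumes "s 1 = 1"
  shows "alg_extend s f (gen \<pi> :: 'k::field_char_0 ncp_alg) = f \<pi>"
  using assms by (simp add: alg_extend_def gen_def)

lemma eps_delta_1: "eps_delta (1 :: 'k::field_char_0 ncp_alg) = 1"
  by (simp add: eps_delta_def alg_extend_def)

section \<open>Algebra morphisms\<close>

lemma alg_morphism_monomial: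
  assumes "alg_morphism (\<phi> :: 'k::field_char_0 ncp_alg \<Rightarrow> 'k poly)"
  shows "\<phi> (Poly_Mapping.single m 1) = (\<Prod>\<rho>\<in>#m. \<phi> (gen \<rho>))"
proof (induction m)
  case empty
  then show ?case using assms by (simp add: alg_morphism_def)
next
  case (add \<rho> m)
  have "Poly_Mapping.single (add_mset \<rho> m) (1::'k) = gen \<rho> * Poly_Mapping.single m 1"
    by (simp add: gen_def mult_single)
  then show ?case using assms add by (simp add: alg_morphism_def)
qed

lemma alg_morphism_ext:
  assumes "alg_morphism (\<phi> :: 'k::field_char_0 ncp_alg \<Rightarrow> 'k poly)" "alg_morphism \<psi>"
    and "\<And>\<rho>. \<phi> (gen \<rho>) = \<psi> (gen \<rho>)"
  shows "\<phi> = \<psi>"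
proof
  fix x :: "'k ncp_alg"
  have *: "\<phi> (Poly_Mapping.single m c) = \<psi> (Poly_Mapping.single m c)" for m c
  proof -
    have "Poly_Mapping.single m c = Poly_Mapping.single 0 c * Poly_Mapping.single m 1"
      by (simp add: mult_single)
    moreover have "\<phi> (Poly_Mapping.single m 1) = \<psi> (Poly_Mapping.single m 1)"
      by (simp only: alg_morphism_monomial[OF assms(1)] alg_morphism_monomial[OF assms(2)] assms(3))
    ultimately show ?thesis
      using assms(1,2) by (metis alg_morphism_def)
  qed
  have add: "\<phi> (x + y) = \<phi> x + \<phi> y" "\<psi> (x + y) = \<psi> x + \<psi> y" for x y
    using assms(1,2) by (simp_all add: alg_morphism_def)
  show "\<phi> x = \<psi> x"
  proof (induction x rule: update_induct)
    case const
    show ?case using *[of 0 0] by simp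
  next
    case (update f m c)
    have "Poly_Mapping.update m c f = Poly_Mapping.single m c + f"
      using update(1) by (intro poly_mapping_eqI)
        (auto simp: lookup_update lookup_add lookup_single when_def in_keys_iff)
    then show ?case using update by (simp add: add *)
  qed
qed

section \<open>Evaluating the left tensor factor at one\<close>

lemma poly_map_poly_const: "poly (map_poly (\<lambda>c. [:c:]) P) [:a:] = [:poly P (a::'k::field_char_0):]"
  by (induction P) (simp_all add: map_poly_pCons)

lemma poly_ptensor_1: "poly (ptensor P Q) 1 = smult (poly P 1) (Q :: 'k::field_char_0 poly)"
  using poly_map_poly_const[of P 1] by (simp add: ptensor_def one_pCons)

lemma poly_poly_Delta_1: "poly (poly_Delta P) 1 = pcompose (P :: 'k::field_char_0 poly) [:1, 1:]"
proof -
  have *: "poly (poly_eval2 P u) 1 = pcompose P (poly u 1)" for u :: "'k poly poly"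
    unfolding poly_eval2_def
    by (induction P) (simp_all add: map_poly_pCons pcompose_pCons)
  show ?thesis unfolding poly_Delta_def *
    by (simp only: poly_add poly_ptensor_1) (simp add: one_pCons)
qed

lemma tensor_map_0: "tensor_map \<phi> (0 :: 'k::field_char_0 ncp_alg2) = 0"
  by (simp add: tensor_map_def)

lemma tensor_map_add:
  "tensor_map \<phi> (u + v) = tensor_map \<phi> u + tensor_map \<phi> (v :: 'k::field_char_0 ncp_alg2)"
proof -
  let ?f = "\<lambda>k c. smult [:c:] (ptensor (\<phi> (Poly_Mapping.single (fst k) 1))
     (\<phi> (Poly_Mapping.single (snd k) 1)))"
  have "tensor_map \<phi> w = (\<Sum>k\<in>Poly_Mapping.keys w. ?f k (Poly_Mapping.lookup w k))"
    for w :: "'k ncp_alg2"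
    by (simp add: tensor_map_def case_prod_beta)
  moreover have "?f k (a + b) = ?f k a + ?f k b" for k a b
    by (metis add.right_neutral add_pCons smult_add_left)
  ultimately show ?thesis
    using setsum_keys_plus_distrib[of ?f u v] by simp
qed

lemma tensor_map_sum:
  "tensor_map \<phi> (\<Sum>i\<in>A. u i) = (\<Sum>i\<in>A. tensor_map \<phi> (u i :: 'k::field_char_0 ncp_alg2))"
  by (induction A rule: infinite_finite_induct) (simp_all add: tensor_map_0 tensor_map_add)

lemma tensor_map_tensor_restrict:
  "tensor_map \<phi> (tensor (restrict_blocks Y) (restrict_blocks_dot J :: 'k::field_char_0 ncp_alg)) =
     ptensor (\<phi> (restrict_blocks Y)) (\<phi> (restrict_blocks_dot J))"
proof -
  obtain m n where
    "restrict_blocks Y = (Poly_Mapping.single m 1 :: 'k ncp_alg)"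
    "restrict_blocks_dot J = (Poly_Mapping.single n 1 :: 'k ncp_alg)"
    using monomial_restrict_blocks[where ?'k = 'k] monomial_restrict_blocks_dot by metis
  then show ?thesis by (simp add: tensor_monomial tensor_map_def flip: one_pCons)
qed

text \<open>Evaluating the left factor of \<open>Delta(\<phi>(\<pi>)) = (\<phi> \<otimes> \<phi>)(Delta \<pi>)\<close> at \<open>1\<close>: on the left this
  substitutes \<open>X + 1\<close> for \<open>X\<close>, on the right the compatibility of \<open>\<phi>\<close> with the counits of
  \<open>\<delta>\<close> replaces \<open>\<phi>\<close> of the left factor by \<open>eps_delta\<close>.\<close>

lemma shifted_morphism_gen:
  assumes "double_bialgebra_morphism (\<phi> :: 'k::field_char_0 ncp_alg \<Rightarrow> 'k poly)"
  shows "pcompose (\<phi> (gen \<pi>)) [:1, 1:] =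
    (\<Sum>J\<in>ideals \<pi>. smult (eps_delta (restrict_blocks (blocks \<pi> - J) :: 'k ncp_alg))
       (\<phi> (restrict_blocks_dot J)))"
proof -
  have "pcompose (\<phi> (gen \<pi>)) [:1, 1:] = poly (tensor_map \<phi> (Delta (gen \<pi>))) 1"
    using assms by (simp add: double_bialgebra_morphism_def poly_poly_Delta_1)
  also have "Delta (gen \<pi>) =
      (\<Sum>J\<in>ideals \<pi>. tensor (restrict_blocks (blocks \<pi> - J)) (restrict_blocks_dot J :: 'k ncp_alg))"
    by (simp add: Delta_def alg_extend_gen)
  finally show ?thesis
    using assms by (simp add: tensor_map_sum tensor_map_tensor_restrict poly_sum poly_ptensor_1
        double_bialgebra_morphism_def)
qed

section \<open>Blocks and restrictions\<close>

lemma ncp_blocksE: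
  obtains n where "n \<ge> 1" "partition_on {1..n} (blocks \<pi>)" "noncrossing (blocks \<pi>)"
  using blocks[of \<pi>] by (auto simp: is_ncp_def)

lemma finite_blocks: "finite (blocks \<pi>)"
  by (metis ncp_blocksE finite_elements finite_atLeastAtMost)

lemma finite_block: "b \<in> blocks \<pi> \<Longrightarrow> finite b"
  by (metis ncp_blocksE partition_onD1 Sup_upper finite_atLeastAtMost finite_subset)

lemma block_nonempty: "b \<in> blocks \<pi> \<Longrightarrow> b \<noteq> {}"
  by (metis ncp_blocksE partition_onD3)

lemma blocks_disjoint: "b \<in> blocks \<pi> \<Longrightarrow> b' \<in> blocks \<pi> \<Longrightarrow> x \<in> b \<Longrightarrow> x \<in> b' \<Longrightarrow> b = b'"
  by (metis ncp_blocksE partition_onD2 disjointD disjoint_iff)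

lemma blocks_nonempty: "blocks \<pi> \<noteq> {}"
  by (rule ncp_blocksE[of \<pi>]) (auto dest!: partition_onD1)

lemma rank_in_strict_mono:
  assumes "finite A" "y \<in> A" "x < y"
  shows "rank_in A x < rank_in A y"
proof -
  have "y \<in> {z \<in> A. z \<le> y} - {z \<in> A. z \<le> x}" "{z \<in> A. z \<le> x} \<subseteq> {z \<in> A. z \<le> y}"
    using assms by auto
  then have "{z \<in> A. z \<le> x} \<subset> {z \<in> A. z \<le> y}" by blast
  then show ?thesis
    unfolding rank_in_def using assms(1) by (intro psubset_card_mono) simp_all
qed

lemma card_renumber:
  assumes "finite (\<Union>Y)"
  shows "card (renumber Y) = card Y"
proof -
  have "inj_on (rank_in (\<Union>Y)) (\<Union>Y)"
    by (rule inj_onI) (metis assms linorder_neqE_nat rank_in_strict_mono less_irrefl)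
  then show ?thesis
    unfolding renumber_def by (rule card_image[OF inj_on_image])
qed

lemma blocks_renumber:
  assumes "Y \<subseteq> blocks \<pi>" "Y \<noteq> {}"
  shows "blocks (Abs_ncp (renumber Y)) = renumber Y"
  using is_ncp_renumber[of "blocks \<pi>" Y] assms blocks[of \<pi>] by (simp add: Abs_ncp_inverse)

lemma num_blocks_renumber:
  assumes "Y \<subseteq> blocks \<pi>" "Y \<noteq> {}"
  shows "num_blocks (Abs_ncp (renumber Y)) = card Y"
proof -
  have "finite (\<Union>Y)"
    using assms finite_blocks finite_block by (meson finite_Union finite_subset subsetD)
  then show ?thesis
    using assms by (simp add: num_blocks_def blocks_renumber card_renumber)
qed

text \<open>The empty restriction is the unit of the algebra, which is why it is not
  killed by the counit although it has no block.\<close>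

lemma eps_delta_restrict_blocks:
  assumes "Y \<subseteq> blocks \<pi>"
  shows "eps_delta (restrict_blocks Y :: 'k::field_char_0 ncp_alg) = (if card Y \<le> 1 then 1 else 0)"
proof (cases "Y = {}")
  case True
  then show ?thesis by (simp add: restrict_blocks_def eps_delta_1)
next
  case False
  then have "card Y > 0"
    using assms finite_blocks by (meson card_gt_0_iff finite_subset)
  then have "card Y = 1 \<longleftrightarrow> card Y \<le> 1" by linarith
  then show ?thesis using False num_blocks_renumber[OF assms False]
    by (simp add: restrict_blocks_def eps_delta_def alg_extend_gen)
qed

section \<open>Runs\<close>

lemma runs_interval:
  assumes "{a..c} \<noteq> {}"
  shows "runs {a..c} = {{a..c}}"
  using assms unfolding runs_def is_run_def by blast

lemma runs_empty: "runs {} = {}"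
  by (auto simp: runs_def is_run_def)

lemma finite_runs: "finite A \<Longrightarrow> finite (runs A)"
  by (rule finite_subset[of _ "Pow A"]) (auto simp: runs_def is_run_def)

lemma run_nonempty_subset: "I \<in> runs A \<Longrightarrow> I \<noteq> {} \<and> I \<subseteq> A"
  by (simp add: runs_def is_run_def)

text \<open>An interval contained in \<open>A \<union> B\<close> misses \<open>p\<close>, so it cannot meet both sides of \<open>p\<close>.\<close>

lemma is_run_Un_gap:
  assumes "\<And>x. x \<in> A \<Longrightarrow> x < p" "\<And>x. x \<in> B \<Longrightarrow> p < x"
  shows "is_run (A \<union> B) I \<longleftrightarrow> is_run A I \<or> is_run B I"
proof
  assume I: "is_run (A \<union> B) I"
  then obtain a c where ac: "I = {a..c}" "I \<noteq> {}" "I \<subseteq> A \<union> B" by (auto simp: is_run_def)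
  have "p \<notin> I" using ac assms by blast
  then have "I \<subseteq> {..<p} \<or> I \<subseteq> {p<..}" using ac(1) by (simp add: subset_iff) linarith
  then have "I \<subseteq> A \<or> I \<subseteq> B" using ac(3) assms by fastforce
  then show "is_run A I \<or> is_run B I" using ac by (auto simp: is_run_def)
qed (auto simp: is_run_def)

lemma runs_Un_gap:
  assumes "\<And>x. x \<in> A \<Longrightarrow> x < p" "\<And>x. x \<in> B \<Longrightarrow> p < (x::nat)"
  shows "runs (A \<union> B) = runs A \<union> runs B"
proof -
  have AB: "A \<inter> B = {}" using assms by fastforce
  have run: "is_run (A \<union> B) I \<longleftrightarrow> is_run A I \<or> is_run B I" for I
    by (rule is_run_Un_gap) (use assms in auto)
  have "\<not> (is_run A I \<and> is_run B I' \<and> (I \<subseteq> I' \<or> I' \<subseteq> I))" for I I'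
    using AB by (auto simp: is_run_def)
  then show ?thesis unfolding runs_def run by blast
qed

text \<open>The multiplicativity behind the three factors of the recurrence: a missing point separates
  the runs, and a nonempty block inside a run of one side belongs to that side.\<close>

lemma restrict_blocks_dot_Un_gap:
  assumes "\<And>x. x \<in> \<Union>J \<Longrightarrow> x < p" "\<And>x. x \<in> \<Union>K \<Longrightarrow> p < x"
    and fin: "finite (\<Union>J)" "finite (\<Union>K)" and ne: "{} \<notin> J" "{} \<notin> K"
  shows "restrict_blocks_dot (J \<union> K) =
    (restrict_blocks_dot J * restrict_blocks_dot K :: 'k::field_char_0 ncp_alg)"
proof -
  have JK: "\<Union>J \<inter> \<Union>K = {}" using assms(1,2) by fastforce
  have runs: "runs (\<Union>(J \<union> K)) = runs (\<Union>J) \<union> runs (\<Union>K)"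
    unfolding Union_Un_distrib by (rule runs_Un_gap) (use assms in auto)
  have disj: "runs (\<Union>J) \<inter> runs (\<Union>K) = {}"
  proof (rule equals0I)
    fix I assume "I \<in> runs (\<Union>J) \<inter> runs (\<Union>K)"
    then have "I \<noteq> {}" "I \<subseteq> \<Union>J \<inter> \<Union>K" using run_nonempty_subset by auto
    then show False using JK by simp
  qed
  have J: "{b \<in> J \<union> K. b \<subseteq> I} = {b \<in> J. b \<subseteq> I}" if "I \<in> runs (\<Union>J)" for I
  proof -
    have "b = {}" if "b \<in> K" "b \<subseteq> I" for b
      using that run_nonempty_subset[OF \<open>I \<in> _\<close>] JK by (metis Sup_upper disjoint_iff_not_equal equals0I subsetD)
    then show ?thesis using ne(2) by auto
  qed
  have K: "{b \<in> J \<union> K. b \<subseteq> I} = {b \<in> K. b \<subseteq> I}" if "I \<in> runs (\<Union>K)" for I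
  proof -
    have "b = {}" if "b \<in> J" "b \<subseteq> I" for b
      using that run_nonempty_subset[OF \<open>I \<in> _\<close>] JK by (metis Sup_upper disjoint_iff_not_equal equals0I subsetD)
    then show ?thesis using ne(1) by auto
  qed
  let ?f = "\<lambda>I. restrict_blocks {b \<in> J \<union> K. b \<subseteq> I} :: 'k ncp_alg"
  have "prod ?f (runs (\<Union>J) \<union> runs (\<Union>K)) = prod ?f (runs (\<Union>J)) * prod ?f (runs (\<Union>K))"
    by (rule prod.union_disjoint) (intro finite_runs fin disj)+
  also have "\<dots> = restrict_blocks_dot J * restrict_blocks_dot K"
    unfolding restrict_blocks_dot_def
    by (intro arg_cong2[where f = "(*)"] prod.cong refl) (simp_all only: J K)
  finally show ?thesis unfolding restrict_blocks_dot_def runs .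
qed

lemma restrict_blocks_dot_interval:
  assumes "\<Union>J = {a..c}" "{} \<notin> J"
  shows "restrict_blocks_dot J = (restrict_blocks J :: 'k::field_char_0 ncp_alg)"
proof (cases "J = {}")
  case True
  then show ?thesis by (simp add: restrict_blocks_dot_def restrict_blocks_def runs_empty)
next
  case False
  then have "{a..c} \<noteq> {}" using assms by auto
  moreover have "{b \<in> J. b \<subseteq> {a..c}} = J" using assms(1) by blast
  ultimately show ?thesis using assms(1)
    by (simp add: restrict_blocks_dot_def runs_interval)
qed

lemma restrict_blocks_dot_blocks:
  "restrict_blocks_dot (blocks \<pi>) = (gen \<pi> :: 'k::field_char_0 ncp_alg)"
proof -
  obtain n where n: "n \<ge> 1" "partition_on {1..n} (blocks \<pi>)" by (rule ncp_blocksE)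
  have U: "\<Union>(blocks \<pi>) = {1..n}" using n(2) by (simp add: partition_on_def)
  have "rank_in {1..n} x = x" if "x \<in> {1..n}" for x
  proof -
    have "{y \<in> {1..n}. y \<le> x} = {1..x}" using that by auto
    then show ?thesis by (simp add: rank_in_def)
  qed
  then have "rank_in {1..n} ` b = b" if "b \<in> blocks \<pi>" for b
    using that U by (intro image_cong[where g = id, simplified]) blast+
  then have "renumber (blocks \<pi>) = blocks \<pi>" by (simp add: renumber_def U)
  then show ?thesis
    using restrict_blocks_dot_interval[OF U] blocks_nonempty block_nonempty
    by (auto simp: restrict_blocks_def blocks_inverse)
qed

section \<open>Removing a base block\<close>

lemma noncrossingD:
  assumes "noncrossing P" "B \<in> P" "C \<in> P" "B \<noteq> C" "x \<in> B" "z \<in> B" "y \<in> C" "t \<in> C"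
  shows "\<not> (x < y \<and> y < z \<and> z < t)"
proof
  assume "x < y \<and> y < z \<and> z < t"
  then have "\<exists>x\<in>B. \<exists>z\<in>B. \<exists>y\<in>C. \<exists>t\<in>C. x < y \<and> y < z \<and> z < t"
    using assms(5-8) by (intro bexI)
  then have "\<exists>b\<in>P. \<exists>b'\<in>P. b \<noteq> b' \<and>
      (\<exists>x\<in>b. \<exists>z\<in>b. \<exists>y\<in>b'. \<exists>t\<in>b'. x < y \<and> y < z \<and> z < t)"
    using assms(2-4) by (intro bexI[of _ B] bexI[of _ C] conjI)
  then show False
    using assms(1) unfolding noncrossing_def by (rule notE[rotated])
qed

text \<open>The position of \<open>c\<close> is read off from its extreme points. If exactly one of \<open>Min b\<close> and \<open>Max b\<close>
  lies strictly between \<open>Min c\<close> and \<open>Max c\<close>, then these four points form a crossing; if both do,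
  then \<open>c\<close> is strictly below \<open>b\<close> in the nesting order.\<close>

lemma base_block_sides:
  assumes b: "b \<in> Base \<pi>" and c: "c \<in> blocks \<pi>" "c \<noteq> b"
  shows "c \<subseteq> {1..<Min b} \<or> c \<subseteq> {Min b..Max b} - b \<or> c \<subseteq> {Max b<..}"
proof -
  obtain n where n: "partition_on {1..n} (blocks \<pi>)" "noncrossing (blocks \<pi>)"
    by (rule ncp_blocksE)
  have bb: "b \<in> blocks \<pi>" using b by (simp add: Base_def)
  have fin: "finite b" "finite c" and ne: "b \<noteq> {}" "c \<noteq> {}"
    using bb c finite_block block_nonempty by auto
  have pq: "Min b \<in> b" "Max b \<in> b" "Min c \<in> c" "Max c \<in> c" using fin ne by auto
  have disj: "x \<notin> b" if "x \<in> c" for x using blocks_disjoint[OF c(1) bb] that c(2) by blast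
  have c1: "c \<subseteq> {1..n}" using n(1) c by (auto simp: partition_on_def)
  note nc = noncrossingD[OF n(2)]
  have "\<not> nest_le c b" using b c by (auto simp: Base_def)
  then have not_around: "\<not> (Min c < Min b \<and> Max b < Max c)"
    using fin ne unfolding nest_le_def by (meson Max_ge Min_le atLeastAtMost_iff le_trans less_imp_le subsetI)
  have neq: "Min c \<noteq> Min b" "Max c \<noteq> Max b" "Max c \<noteq> Min b" "Min c \<noteq> Max b"
    using disj pq by metis+
  consider "Max c < Min b" | "Max b < Min c" | "Min b < Min c" "Max c < Max b"
    | "Min c < Min b" "Min b < Max c" "Max c < Max b"
    | "Min b < Min c" "Min c < Max b" "Max b < Max c"
    | "Min c < Min b" "Max b < Max c"
    using neq by (meson linorder_neqE_nat)
  then show ?thesis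
  proof cases
    case 1
    have "x \<in> {1..<Min b}" if "x \<in> c" for x
      using Max_ge[OF fin(2) that] 1 that c1 by auto
    then show ?thesis by blast
  next
    case 2
    have "x \<in> {Max b<..}" if "x \<in> c" for x
      using Min_le[OF fin(2) that] 2 by simp
    then show ?thesis by blast
  next
    case 3
    have "x \<in> {Min b..Max b} - b" if "x \<in> c" for x
      using Min_le[OF fin(2) that] Max_ge[OF fin(2) that] 3 disj[OF that] by auto
    then show ?thesis by blast
  next
    case 4 then show ?thesis using nc[OF c(1) bb c(2) pq(3,4,1,2)] by simp
  next
    case 5 then show ?thesis using nc[OF bb c(1) c(2)[symmetric] pq(1,2,3,4)] by simp
  next
    case 6 then show ?thesis using not_around by blast
  qed
qed

lemma restrict_blocks_dot_remove_base:
  assumes b: "b \<in> Base \<pi>"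
  shows "restrict_blocks_dot (blocks \<pi> - {b}) =
    (restrict_to \<pi> {1..<Min b} * restrict_dot_to \<pi> ({Min b..Max b} - b) *
     restrict_to \<pi> {Max b<..} :: 'k::field_char_0 ncp_alg)"
proof -
  obtain n where n: "partition_on {1..n} (blocks \<pi>)" by (rule ncp_blocksE)
  then have U: "\<Union>(blocks \<pi>) = {1..n}" by (simp add: partition_on_def)
  have bb: "b \<in> blocks \<pi>" using b by (simp add: Base_def)
  then have fb: "finite b" "b \<noteq> {}" using finite_block block_nonempty by auto
  then have pq: "Min b \<in> b" "Max b \<in> b" "Min b \<le> Max b" by auto
  have b1: "b \<subseteq> {1..n}" using bb U by blast
  define L M R where "L = {c \<in> blocks \<pi>. c \<subseteq> {1..<Min b}}"
    and "M = {c \<in> blocks \<pi>. c \<subseteq> {Min b..Max b} - b}"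
    and "R = {c \<in> blocks \<pi>. c \<subseteq> {Max b<..}}"
  have split: "blocks \<pi> - {b} = L \<union> M \<union> R"
  proof
    show "blocks \<pi> - {b} \<subseteq> L \<union> M \<union> R"
      using base_block_sides[OF b] unfolding L_def M_def R_def by blast
    show "L \<union> M \<union> R \<subseteq> blocks \<pi> - {b}"
      using pq unfolding L_def M_def R_def by auto
  qed
  \<comment> \<open>Elements of the outer zones are outside \<open>b\<close>, so the blocks of these zones fill them and the
    unions are intervals.\<close>
  have cover: "x \<in> \<Union>L \<union> \<Union>M \<union> \<Union>R" if "x \<in> {1..n}" "x \<notin> b" for x
    using that U split by blast
  have sub: "\<Union>L \<subseteq> {1..<Min b}" "\<Union>M \<subseteq> {Min b..Max b} - b" "\<Union>R \<subseteq> {Max b<..}"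
    "\<Union>R \<subseteq> {1..n}"
    using U by (auto simp: L_def M_def R_def)
  have "x \<in> \<Union>L" if "x \<in> {1..<Min b}" for x
  proof -
    have "x \<notin> b" using that fb by (auto dest: Min_le)
    moreover have "x \<in> {1..n}" using that pq(1) b1 by fastforce
    ultimately show ?thesis using cover[of x] that sub pq by fastforce
  qed
  then have UL: "\<Union>L = {1..Min b - 1}" using sub(1) by fastforce
  have "x \<in> \<Union>R" if "x \<in> {Max b<..n}" for x
  proof -
    have "x \<notin> b" using that fb by (auto dest: Max_ge)
    moreover have "x \<in> {1..n}" using that pq(2) b1 by fastforce
    ultimately show ?thesis using cover[of x] that sub pq by fastforce
  qed
  then have UR: "\<Union>R = {Suc (Max b)..n}" using sub(3,4) by fastforce
  have fin: "finite (\<Union>L)" "finite (\<Union>M)" "finite (\<Union>R)"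
    using finite_subset[OF sub(1)] finite_subset[OF sub(2)] finite_subset[OF sub(4)] by auto
  have ne: "{} \<notin> L" "{} \<notin> M" "{} \<notin> R"
    using block_nonempty by (auto simp: L_def M_def R_def)
  have "restrict_blocks_dot (L \<union> M \<union> R) =
      (restrict_blocks_dot (L \<union> M) * restrict_blocks_dot R :: 'k ncp_alg)"
  proof (rule restrict_blocks_dot_Un_gap[where p = "Max b"])
    fix x assume "x \<in> \<Union>(L \<union> M)"
    then consider "x \<in> {1..<Min b}" | "x \<in> {Min b..Max b} - b" using sub(1,2) by blast
    then show "x < Max b"
    proof cases
      case 2
      then have "x \<le> Max b" "x \<noteq> Max b" using pq(2) by auto
      then show ?thesis by simp
    qed (use pq(3) in simp)
  qed (use sub fin ne in auto)
  also have "restrict_blocks_dot (L \<union> M) =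
      (restrict_blocks_dot L * restrict_blocks_dot M :: 'k ncp_alg)"
  proof (rule restrict_blocks_dot_Un_gap[where p = "Min b"])
    fix x assume "x \<in> \<Union>M"
    then have "x \<in> {Min b..Max b} - b" using sub(2) by blast
    then have "Min b \<le> x" "x \<noteq> Min b" using pq(1) by auto
    then show "Min b < x" by simp
  qed (use sub fin ne in auto)
  finally show ?thesis
    unfolding split restrict_to_def restrict_dot_to_def L_def[symmetric] M_def[symmetric]
      R_def[symmetric]
    by (simp add: restrict_blocks_dot_interval[OF UL ne(1)] restrict_blocks_dot_interval[OF UR ne(3)])
qed

lemma blocks_in_ideals: "blocks \<pi> \<in> ideals \<pi>"
  by (simp add: ideals_def)

lemma remove_block_ideal_iff:
  assumes "b \<in> blocks \<pi>"
  shows "blocks \<pi> - {b} \<in> ideals \<pi> \<longleftrightarrow> b \<in> Base \<pi>"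
  using assms by (auto simp: ideals_def Base_def)

lemma finite_ideals: "finite (ideals \<pi>)"
  by (rule finite_subset[of _ "Pow (blocks \<pi>)"]) (auto simp: ideals_def finite_blocks)

text \<open>These are the ideals that the counit of \<open>\<delta>\<close> does not kill.\<close>

lemma ideals_small_complement:
  "{J \<in> ideals \<pi>. card (blocks \<pi> - J) \<le> 1} = insert (blocks \<pi>) ((\<lambda>b. blocks \<pi> - {b}) ` Base \<pi>)"
proof (intro set_eqI iffI)
  fix J assume "J \<in> {J \<in> ideals \<pi>. card (blocks \<pi> - J) \<le> 1}"
  then have J: "J \<in> ideals \<pi>" "J \<subseteq> blocks \<pi>" and c: "card (blocks \<pi> - J) \<le> 1"
    by (auto simp: ideals_def)
  show "J \<in> insert (blocks \<pi>) ((\<lambda>b. blocks \<pi> - {b}) ` Base \<pi>)"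
  proof (cases "blocks \<pi> - J = {}")
    case True
    then show ?thesis using J by blast
  next
    case False
    have "finite (blocks \<pi> - J)" using finite_blocks by blast
    with False have "card (blocks \<pi> - J) > 0" by (simp add: card_gt_0_iff)
    with c have "card (blocks \<pi> - J) = 1" by linarith
    then obtain b where "blocks \<pi> - J = {b}" by (rule card_1_singletonE)
    then have "b \<in> blocks \<pi>" "J = blocks \<pi> - {b}" using J by auto
    then have "b \<in> Base \<pi>" using J(1) remove_block_ideal_iff by metis
    then show ?thesis using \<open>J = blocks \<pi> - {b}\<close> by (intro insertI2 image_eqI)
  qed
next
  fix J assume "J \<in> insert (blocks \<pi>) ((\<lambda>b. blocks \<pi> - {b}) ` Base \<pi>)"
  then show "J \<in> {J \<in> ideals \<pi>. card (blocks \<pi> - J) \<le> 1}"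
  proof
    assume "J \<in> (\<lambda>b. blocks \<pi> - {b}) ` Base \<pi>"
    then obtain b where b: "b \<in> Base \<pi>" "J = blocks \<pi> - {b}" by blast
    then have bb: "b \<in> blocks \<pi>" by (simp add: Base_def)
    then have "blocks \<pi> - J = {b}" using b(2) by blast
    moreover have "J \<in> ideals \<pi>" using b bb remove_block_ideal_iff by simp
    ultimately show ?thesis by simp
  qed (simp add: blocks_in_ideals)
qed

lemma morphism_recurrence:
  assumes "double_bialgebra_morphism (\<phi> :: 'k::field_char_0 ncp_alg \<Rightarrow> 'k poly)"
  shows "pcompose (\<phi> (gen \<pi>)) [:1, 1:] = \<phi> (gen \<pi>) + base_sum \<phi> \<pi>"
proof -
  let ?f = "\<lambda>J. \<phi> (restrict_blocks_dot J)"
  let ?rem = "\<lambda>b. blocks \<pi> - {b}"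
  have Bsub: "Base \<pi> \<subseteq> blocks \<pi>" by (auto simp: Base_def)
  then have finB: "finite (Base \<pi>)" using finite_blocks finite_subset by blast
  have inj: "inj_on ?rem (Base \<pi>)" using Bsub by (auto simp: inj_on_def)
  have "pcompose (\<phi> (gen \<pi>)) [:1, 1:] =
      (\<Sum>J\<in>ideals \<pi>. if card (blocks \<pi> - J) \<le> 1 then ?f J else 0)"
    unfolding shifted_morphism_gen[OF assms]
    by (intro sum.cong) (auto simp: eps_delta_restrict_blocks[OF Diff_subset])
  also have "\<dots> = (\<Sum>J\<in>{J \<in> ideals \<pi>. card (blocks \<pi> - J) \<le> 1}. ?f J)"
    by (simp add: sum.inter_filter finite_ideals)
  also have "\<dots> = ?f (blocks \<pi>) + (\<Sum>J\<in>?rem ` Base \<pi>. ?f J)"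
    unfolding ideals_small_complement using Bsub finB by (subst sum.insert) auto
  also have "(\<Sum>J\<in>?rem ` Base \<pi>. ?f J) = (\<Sum>b\<in>Base \<pi>. ?f (?rem b))"
    using inj by (simp add: sum.reindex)
  also have "\<dots> = base_sum \<phi> \<pi>"
    unfolding base_sum_def
    using assms by (intro sum.cong)
      (simp_all add: restrict_blocks_dot_remove_base double_bialgebra_morphism_def alg_morphism_def)
  finally show ?thesis by (simp add: restrict_blocks_dot_blocks)
qed

section \<open>Uniqueness\<close>

lemma ncps_in_prod:
  "ncps_in (prod f A :: 'k::field_char_0 ncp_alg) \<subseteq> (\<Union>i\<in>A. ncps_in (f i))"
proof (induction A rule: infinite_finite_induct)
  case (insert i A)
  have "ncps_in (x * y) \<subseteq> ncps_in x \<union> ncps_in y" for x y :: "'k ncp_alg"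
    unfolding ncps_in_def using keys_mult[of x y] by fastforce
  then show ?case using insert by fastforce
qed (simp_all add: ncps_in_def)

lemma num_blocks_restrict_blocks_less:
  assumes "Y \<subset> blocks \<pi>" "\<rho> \<in> ncps_in (restrict_blocks Y :: 'k::field_char_0 ncp_alg)"
  shows "num_blocks \<rho> < num_blocks \<pi>"
proof -
  have "Y \<noteq> {}" "\<rho> = Abs_ncp (renumber Y)"
    using assms(2) by (auto simp: restrict_blocks_def ncps_in_def gen_def split: if_splits)
  then show ?thesis
    using assms(1) num_blocks_renumber[of Y \<pi>] psubset_card_mono[OF finite_blocks assms(1)]
    by (simp add: num_blocks_def)
qed

lemma num_blocks_base_factor_less:
  assumes "b \<in> Base \<pi>"
    and "\<rho> \<in> ncps_in (restrict_to \<pi> {1..<Min b} :: 'k::field_char_0 ncp_alg) \<union>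
          ncps_in (restrict_dot_to \<pi> ({Min b..Max b} - b) :: 'k ncp_alg) \<union>
          ncps_in (restrict_to \<pi> {Max b<..} :: 'k ncp_alg)"
  shows "num_blocks \<rho> < num_blocks \<pi>"
proof -
  have bb: "b \<in> blocks \<pi>" using assms(1) by (simp add: Base_def)
  then have "finite b" "b \<noteq> {}" using finite_block block_nonempty by auto
  then have pq: "Min b \<in> b" "Max b \<in> b" by auto
  have less: "num_blocks \<rho> < num_blocks \<pi>"
    if "\<rho> \<in> ncps_in (restrict_blocks Y :: 'k ncp_alg)" "Y \<subseteq> {c \<in> blocks \<pi>. c \<subseteq> S}"
      "S = {1..<Min b} \<or> S = {Min b..Max b} - b \<or> S = {Max b<..}" for Y S
  proof (rule num_blocks_restrict_blocks_less[OF _ that(1)])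
    have "\<not> b \<subseteq> S" using that(3) pq by auto
    then show "Y \<subset> blocks \<pi>" using that(2) bb by blast
  qed
  from assms(2) consider
      "\<rho> \<in> ncps_in (restrict_to \<pi> {1..<Min b} :: 'k ncp_alg)"
    | "\<rho> \<in> ncps_in (restrict_dot_to \<pi> ({Min b..Max b} - b) :: 'k ncp_alg)"
    | "\<rho> \<in> ncps_in (restrict_to \<pi> {Max b<..} :: 'k ncp_alg)"
    by (elim UnE)
  then show ?thesis
  proof cases
    case 1
    then show ?thesis unfolding restrict_to_def by (rule less[where S = "{1..<Min b}"]) simp_all
  next
    case 2
    then obtain I where "\<rho> \<in> ncps_in (restrict_blocks
        {c \<in> {c \<in> blocks \<pi>. c \<subseteq> {Min b..Max b} - b}. c \<subseteq> I} :: 'k ncp_alg)"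
      unfolding restrict_dot_to_def restrict_blocks_dot_def by (auto dest: subsetD[OF ncps_in_prod])
    then show ?thesis by (rule less[where S = "{Min b..Max b} - b"]) auto
  next
    case 3
    then show ?thesis unfolding restrict_to_def by (rule less[where S = "{Max b<..}"]) simp_all
  qed
qed

text \<open>The difference of two solutions is invariant under the shift, so it takes the value \<open>0\<close> at every
  natural number.\<close>

lemma shift_zero_unique:
  fixes P :: "'k::field_char_0 poly"
  assumes "poly P 0 = 0" "pcompose P [:1, 1:] = P + S"
    and "poly Q 0 = 0" "pcompose Q [:1, 1:] = Q + S"
  shows "P = Q"
proof -
  define D where "D = P - Q"
  have D: "pcompose D [:1, 1:] = D" using assms by (simp add: D_def pcompose_diff)
  have "poly D (of_nat n) = 0" for n
  proof (induction n)
    case (Suc n)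
    have "poly (pcompose D [:1, 1:]) (of_nat n) = poly D (of_nat (Suc n))"
      by (simp add: poly_pcompose algebra_simps)
    then show ?case using Suc D by simp
  qed (simp add: D_def assms)
  then have "range (of_nat :: nat \<Rightarrow> 'k) \<subseteq> {x. poly D x = 0}" by auto
  then have "infinite {x. poly D x = 0}"
    using infinite_UNIV_nat inj_of_nat by (metis finite_imageD finite_subset)
  then show ?thesis using poly_roots_finite[of D] by (auto simp: D_def)
qed

lemma alg_morphism_cong_ncps_in:
  assumes "alg_morphism (\<phi> :: 'k::field_char_0 ncp_alg \<Rightarrow> 'k poly)" "alg_morphism \<psi>"
    and "x = Poly_Mapping.single m 1" "\<And>\<rho>. \<rho> \<in> ncps_in x \<Longrightarrow> \<phi> (gen \<rho>) = \<psi> (gen \<rho>)"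
  shows "\<phi> x = \<psi> x"
  using assms(3,4) unfolding ncps_in_def
  by (auto simp: alg_morphism_monomial[OF assms(1)] alg_morphism_monomial[OF assms(2)]
      intro!: arg_cong[where f = prod_mset] image_mset_cong)

lemma base_sum_cong:
  assumes mor: "alg_morphism (\<phi> :: 'k::field_char_0 ncp_alg \<Rightarrow> 'k poly)" "alg_morphism \<psi>"
    and eq: "\<And>\<rho>. num_blocks \<rho> < num_blocks \<pi> \<Longrightarrow> \<phi> (gen \<rho>) = \<psi> (gen \<rho>)"
  shows "base_sum \<phi> \<pi> = base_sum \<psi> \<pi>"
  unfolding base_sum_def
proof (rule sum.cong[OF refl])
  fix b assume b: "b \<in> Base \<pi>"
  note cong = alg_morphism_cong_ncps_in[OF mor]
  have mono: "\<exists>m. restrict_to \<pi> S = (Poly_Mapping.single m 1 :: 'k ncp_alg)"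
    "\<exists>m. restrict_dot_to \<pi> S = (Poly_Mapping.single m 1 :: 'k ncp_alg)" for S
    unfolding restrict_to_def restrict_dot_to_def
    using monomial_restrict_blocks monomial_restrict_blocks_dot by blast+
  have "\<phi> x = \<psi> x" if "x \<in> {restrict_to \<pi> {1..<Min b}, restrict_dot_to \<pi> ({Min b..Max b} - b),
      restrict_to \<pi> {Max b<..}}" for x
  proof -
    have "\<exists>m. x = Poly_Mapping.single m 1"
      using that by (elim insertE emptyE) (simp_all only: mono)
    then obtain m where "x = Poly_Mapping.single m 1" ..
    moreover have "\<phi> (gen \<rho>) = \<psi> (gen \<rho>)" if "\<rho> \<in> ncps_in x" for \<rho>
      using num_blocks_base_factor_less[OF b, of \<rho>, where ?'k = 'k] that \<open>x \<in> _\<close>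
      by (intro eq) blast
    ultimately show ?thesis by (rule cong)
  qed
  then show "\<phi> (restrict_to \<pi> {1..<Min b}) * \<phi> (restrict_dot_to \<pi> ({Min b..Max b} - b)) *
      \<phi> (restrict_to \<pi> {Max b<..}) =
      \<psi> (restrict_to \<pi> {1..<Min b}) * \<psi> (restrict_dot_to \<pi> ({Min b..Max b} - b)) *
      \<psi> (restrict_to \<pi> {Max b<..})"
    by simp
qed

lemma recurrence_unique:
  assumes "alg_morphism (\<phi> :: 'k::field_char_0 ncp_alg \<Rightarrow> 'k poly)" "alg_morphism \<psi>"
    and "\<And>\<rho>. poly (\<phi> (gen \<rho>)) 0 = 0" "\<And>\<rho>. poly (\<psi> (gen \<rho>)) 0 = 0"
    and "\<And>\<rho>. pcompose (\<phi> (gen \<rho>)) [:1, 1:] = \<phi> (gen \<rho>) + base_sum \<phi> \<rho>"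
    and "\<And>\<rho>. pcompose (\<psi> (gen \<rho>)) [:1, 1:] = \<psi> (gen \<rho>) + base_sum \<psi> \<rho>"
  shows "\<phi> = \<psi>"
proof (rule alg_morphism_ext[OF assms(1,2)])
  fix \<rho>
  show "\<phi> (gen \<rho>) = \<psi> (gen \<rho>)"
  proof (induction "num_blocks \<rho>" arbitrary: \<rho> rule: less_induct)
    case less
    have "base_sum \<phi> \<rho> = base_sum \<psi> \<rho>"
      by (rule base_sum_cong[OF assms(1,2)]) (rule less)
    then show ?case
      using shift_zero_unique[OF assms(3)[of \<rho>] assms(5)[of \<rho>] assms(4)[of \<rho>]] assms(6)[of \<rho>]
      by simp
  qed
qed

theorem proposition3p2:
  fixes \<phi> :: "'k::field_char_0 ncp_alg \<Rightarrow> 'k poly" and \<pi> :: ncp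
  assumes "double_bialgebra_morphism \<phi>"
  shows
    "pcompose (\<phi> (gen \<pi>)) [:1, 1:] = \<phi> (gen \<pi>) +
       (\<Sum>b\<in>Base \<pi>.
          \<phi> (restrict_to \<pi> {1..<Min b}) *
          \<phi> (restrict_dot_to \<pi> ({Min b..Max b} - b)) *
          \<phi> (restrict_to \<pi> {Max b<..}))
     \<and> poly (\<phi> (gen \<pi>)) 0 = 0
     \<and> (\<forall>b\<in>Base \<pi>. \<forall>\<rho>\<in>
          ncps_in (restrict_to \<pi> {1..<Min b} :: 'k ncp_alg) \<union>
          ncps_in (restrict_dot_to \<pi> ({Min b..Max b} - b) :: 'k ncp_alg) \<union>
          ncps_in (restrict_to \<pi> {Max b<..} :: 'k ncp_alg).
            num_blocks \<rho> < num_blocks \<pi>)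
     \<and> (\<forall>P. poly P 0 = 0 \<and> pcompose P [:1, 1:] = P + base_sum \<phi> \<pi> \<longrightarrow> P = \<phi> (gen \<pi>))
     \<and> (\<forall>\<psi>. alg_morphism \<psi> \<and>
          (\<forall>\<rho>. poly (\<psi> (gen \<rho>)) 0 = 0 \<and>
               pcompose (\<psi> (gen \<rho>)) [:1, 1:] = \<psi> (gen \<rho>) + base_sum \<psi> \<rho>) \<longrightarrow>
          \<psi> = \<phi>)"
proof -
  have mor: "alg_morphism \<phi>" using assms by (simp add: double_bialgebra_morphism_def)
  have zero: "poly (\<phi> (gen \<rho>)) 0 = 0" for \<rho>
    using assms by (simp add: double_bialgebra_morphism_def eps_Delta_def alg_extend_gen)
  note rec = morphism_recurrence[OF assms]
  have "\<psi> = \<phi>" if "alg_morphism \<psi>" "\<forall>\<rho>. poly (\<psi> (gen \<rho>)) 0 = 0 \<and>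
      pcompose (\<psi> (gen \<rho>)) [:1, 1:] = \<psi> (gen \<rho>) + base_sum \<psi> \<rho>" for \<psi>
    using that zero rec by (intro recurrence_unique[OF _ mor]) simp_all
  moreover have "P = \<phi> (gen \<pi>)" if "poly P 0 = 0" "pcompose P [:1, 1:] = P + base_sum \<phi> \<pi>" for P
    using shift_zero_unique[OF that zero rec] .
  moreover note rec[of \<pi>, unfolded base_sum_def] zero[of \<pi>] num_blocks_base_factor_less[of _ \<pi>]
  ultimately show ?thesis by blast
qed

end
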